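(* Let $n>1$ be an integer, let $q=2^n$, and let $a\in\mathbb{F}_{q^4}^*$. Then the polynomial $$f_3(x)=x^{\frac{(q^4-1)+(q^3-q^2+q-1)}{2}+1}+ax=x^{\frac{q^4+q^3-q^2+q}{2}}+ax$$ is a permutation polynomial of $\mathbb{F}_{q^4}$ if and only if $a\in\mu_{q^2-1}$ and $a\notin\mu_{q+1}$.
   Context: $\mathbb{F}_Q$ denotes the finite field with $Q$ elements and $\mathbb{F}_Q^*$ its nonzero elements. A polynomial $f\in\mathbb{F}_Q[x]$ is a permutation polynomial of $\mathbb{F}_Q$ if the map $c\mapsto f(c)$ is a bijection of $\mathbb{F}_Q$. For a positive integer $d$, $\mu_d$ denotes the set of $d$-th roots of unity (elements $u$ with $u^d=1$). *)

theory Defs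
  imports "HOL-Computational_Algebra.Polynomial"
begin

definition permutation_poly :: "'a::{field,finite} poly \<Rightarrow> bool" where
  "permutation_poly f \<longleftrightarrow> bij (poly f)"

definition mu :: "nat \<Rightarrow> 'a::field set" where
  "mu d = {u. u ^ d = 1}"

end

theory Submission
  imports Defs
begin

text \<open>
  Let \<open>K\<close> be the field with \<open>q\<^sup>4\<close> elements, \<open>F x = x\<^sup>q\<close>, and call \<open>t\<close> unimodular if \<open>t * F t = 1\<close>,
  that is, \<open>t \<in> \<mu>\<^bsub>q+1\<^esub>\<close>. Squaring is an automorphism of \<open>K\<close>, so \<open>f\<^sub>3\<close> permutes \<open>K\<close> iff
  its square does, and reducing exponents with \<open>x ^ (q ^ 4) = x\<close> gives
  \<open>f\<^sub>3(x)\<^sup>2 = x\<^sup>2 (M x + b)\<close> with \<open>b = a\<^sup>2\<close> and \<open>M x = F x * F\<^sup>3 x / (x * F\<^sup>2 x)\<close>.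
  The map \<open>M\<close> is a homomorphism from the nonzero elements of \<open>K\<close> onto the unimodular ones.

  Fix \<open>b\<close> and put \<open>g x = x\<^sup>2 (M x + b)\<close>. If \<open>b\<close> is unimodular, then \<open>b = M x\<close> for some \<open>x\<close>,
  and \<open>g x = 0 = g 0\<close>. Otherwise \<open>g\<close> vanishes only at \<open>0\<close>. As \<open>x\<close> is determined by \<open>g x\<close> and
  \<open>M x\<close>, and \<open>M (g x)\<close> depends on \<open>t = M x\<close> only, \<open>g\<close> is injective iff the induced map
  \<open>G t = t\<^sup>2 M (t + b) = (1 + F b t) (1 + F\<^sup>3 b t) / ((t + b) (t + F\<^sup>2 b))\<close>
  is injective on the unimodular elements. If \<open>F\<^sup>2 b = b\<close>, then \<open>G\<close> is the square of the
  fractional linear map \<open>t \<mapsto> (1 + F b t) / (t + b)\<close>, which is injective because \<open>b * F b \<noteq> 1\<close>.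
  If \<open>F\<^sup>2 b \<noteq> b\<close>, then \<open>G s = G t\<close> follows from a symmetric bilinear equation
  \<open>A + E (s + t) + F A * s * t = 0\<close> with \<open>F E = E\<close>. For given unimodular \<open>s\<close> its solution \<open>t\<close> is
  unimodular again, or else every \<open>t\<close> is a solution, and in characteristic 2 the diagonal
  \<open>s = t\<close> solves it for at most one \<open>s\<close>, unless \<open>A = 0\<close>, in which case \<open>E = 0\<close> as well. Hence some solution has \<open>s \<noteq> t\<close>.
\<close>

section \<open>Frobenius in a field with \<open>q\<^sup>4\<close> elements, \<open>q\<close> a power of 2\<close>

text \<open>Multiplication by a nonzero \<open>x\<close> permutes the nonzero elements, so it fixes their product.\<close>

lemma finite_field_power_card:
  fixes x :: "'a::{field,finite}"
  shows "x ^ card (UNIV :: 'a set) = x"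
proof (cases "x = 0")
  case True
  then show ?thesis by (simp add: zero_power finite_UNIV_card_ge_0)
next
  case False
  let ?U = "UNIV - {0 :: 'a}"
  have "bij_betw ((*) x) ?U ?U"
    using False by (intro bij_betw_byWitness[where f' = "\<lambda>y. y / x"]) auto
  then have "(\<Prod>y\<in>?U. x * y) = \<Prod>?U"
    by (rule prod.reindex_bij_betw)
  moreover have "\<Prod>?U \<noteq> 0" by simp
  ultimately have "x ^ card ?U = 1" by (simp add: prod.distrib)
  moreover have "card (UNIV :: 'a set) = Suc (card ?U)"
    by (intro card.remove) auto
  ultimately show ?thesis by (simp only: power_Suc mult_1_right)
qed

locale char2_quartic_field =
  fixes n q :: nat and field_type :: "'a::{field,finite} itself"
  assumes n_pos: "n > 0" and q_def: "q = 2 ^ n"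
    and card_field: "card (UNIV :: 'a set) = q ^ 4"
begin

lemma q_ge_2: "q \<ge> 2"
  using n_pos power_increasing[of 1 n "2::nat"] by (simp add: q_def)

lemma even_q: "even q"
  using n_pos by (simp add: q_def)

lemma power_q4: "x ^ q ^ 4 = (x :: 'a)"
  using finite_field_power_card[of x] by (simp add: card_field)

text \<open>As \<open>q\<^sup>4\<close> is even, \<open>-1 = (-1) ^ (q ^ 4) = 1\<close>.\<close>

lemma char_2: "(1::'a) + 1 = 0"
proof -
  have "(-1 :: 'a) ^ q ^ 4 = 1" using even_q by simp
  then show ?thesis using power_q4[of "-1"] by (simp add: eq_neg_iff_add_eq_0)
qed

lemma double: "(x::'a) + x = 0"
  using char_2 by (metis distrib_left mult_1_right mult_zero_right)

lemma add_eq_0_iff_eq: "(x::'a) + y = 0 \<longleftrightarrow> x = y"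
  using double by (metis add_right_imp_eq)

lemma CHAR_field: "CHAR('a) = 2"
proof (rule CHAR_eqI)
  show "of_nat 2 = (0::'a)" using char_2 by (simp only: of_nat_numeral one_add_one)
next
  fix m assume m: "of_nat m = (0::'a)"
  show "2 dvd m"
  proof (rule ccontr)
    assume "odd m"
    then obtain k where "m = 2 * k + 1" by (rule oddE)
    then have "m = k + k + 1" by simp
    then have "of_nat m = (of_nat k + of_nat k) + (1::'a)" by (simp only: of_nat_add of_nat_1)
    with m show False by (simp only: double add_0 one_neq_zero)
  qed
qed

definition F :: "'a \<Rightarrow> 'a" where "F x = x ^ q"

lemma F_mult: "F (x * y) = F x * F y"
  and F_divide: "F (x / y) = F x / F y"
  and F_minus: "F (- x) = - F x"
  and F_power: "F (x ^ k) = F x ^ k"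
  and F_0: "F 0 = 0" and F_1: "F 1 = 1"
  using q_ge_2 even_q
  by (simp_all add: F_def power_mult_distrib power_divide eq_neg_iff_add_eq_0 double
      power_commutes mult.commute[of k] flip: power_mult)

lemma F_add: "F (x + y) = F x + F y"
  unfolding F_def by (rule freshmans_dream'[where n = n]) (simp_all add: CHAR_field q_def)

lemma F_diff: "F (x - y) = F x - F y"
  using F_add[of x "- y"] by (simp add: F_minus)

lemma F_eq_0: "F x = 0 \<longleftrightarrow> x = 0"
  using q_ge_2 by (simp add: F_def)

lemma F_F: "F (F x) = x ^ q\<^sup>2"
  by (simp add: F_def power2_eq_square flip: power_mult)

lemma F_F_F: "F (F (F x)) = x ^ q ^ 3"
  by (simp add: F_def power3_eq_cube flip: power_mult)

lemma F_order: "F (F (F (F x))) = x"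
  using power_q4[of x] by (simp add: F_def eval_nat_numeral mult.assoc flip: power_mult)

lemmas F_simps = F_mult F_divide F_minus F_power F_0 F_1 F_add F_diff F_eq_0 F_order

lemma square_add: "(x + y)\<^sup>2 = x\<^sup>2 + (y::'a)\<^sup>2"
  by (rule freshmans_dream) (simp_all add: CHAR_field)

lemma square_inj: "x\<^sup>2 = y\<^sup>2 \<longleftrightarrow> x = (y::'a)"
proof
  assume "x\<^sup>2 = y\<^sup>2"
  then have "(x - y) * (x + y) = 0" by (simp add: power2_eq_square algebra_simps)
  then show "x = y" by (auto simp: add_eq_0_iff_eq)
qed simp

lemma square_root_exists: "\<exists>y. y\<^sup>2 = (x::'a)"
proof -
  have "inj (\<lambda>y::'a. y\<^sup>2)" by (auto intro: injI simp: square_inj)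
  then have "surj (\<lambda>y::'a. y\<^sup>2)" by (rule finite_UNIV_inj_surj[OF finite])
  then show ?thesis by (metis surjD)
qed

section \<open>A homomorphism onto the unimodular elements\<close>

definition unimodular :: "'a \<Rightarrow> bool" where "unimodular t \<longleftrightarrow> t * F t = 1"

text \<open>
  On nonzero \<open>x\<close> this is the power \<open>x ^ ((q - 1) * (q\<^sup>2 + 1))\<close>. Written with \<open>F\<close> it is visibly
  multiplicative, and \<open>F\<close> visibly inverts it.
\<close>

definition M :: "'a \<Rightarrow> 'a" where "M x = F x * F (F (F x)) / (x * F (F x))"

lemma unimodularD:
  assumes "unimodular t"
  shows "t \<noteq> 0" "F t = 1 / t"
proof -
  show "t \<noteq> 0" using assms by (auto simp: unimodular_def)
  then show "F t = 1 / t" using assms by (simp add: unimodular_def eq_divide_eq mult.commute)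
qed

lemma unimodular_iff_mu: "unimodular t \<longleftrightarrow> t \<in> mu (q + 1)"
  by (simp add: unimodular_def mu_def F_def)

lemma F_F_fixed_iff_mu: "t \<noteq> 0 \<Longrightarrow> F (F t) = t \<longleftrightarrow> t \<in> mu (q\<^sup>2 - 1)"
proof -
  assume "t \<noteq> 0"
  have "q\<^sup>2 = Suc (q\<^sup>2 - 1)" using q_ge_2 by simp
  then have "F (F t) = t * t ^ (q\<^sup>2 - 1)" by (metis F_F power_Suc)
  with \<open>t \<noteq> 0\<close> show ?thesis by (auto simp: mu_def)
qed

lemma unimodular_square_iff: "unimodular (t\<^sup>2) \<longleftrightarrow> unimodular t"
  using square_inj[of "t * F t" 1] by (simp add: unimodular_def F_power power_mult_distrib)

lemma F_F_fixed_square_iff: "F (F (t\<^sup>2)) = t\<^sup>2 \<longleftrightarrow> F (F t) = t"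
  by (simp add: F_power square_inj)

lemma M_mult: "M (x * y) = M x * M y"
  by (simp add: M_def F_simps mult_ac)

lemma M_power: "M (x ^ k) = M x ^ k"
  by (simp add: M_def F_simps power_mult_distrib power_divide)

lemma M_divide: "M (x / y) = M x / M y"
  by (simp add: M_def F_simps)

lemma M_eq_0: "M x = 0 \<longleftrightarrow> x = 0"
  by (simp add: M_def F_simps)

lemma unimodular_M: "x \<noteq> 0 \<Longrightarrow> unimodular (M x)"
  by (simp add: unimodular_def M_def F_simps)

lemma M_unimodular:
  assumes "unimodular v"
  shows "M v = 1 / v ^ 4"
  by (simp add: M_def F_divide F_1 unimodularD[OF assms] eval_nat_numeral)

text \<open>Since \<open>M v = v\<^sup>-\<^sup>4\<close> on unimodular \<open>v\<close>, a fourth root of \<open>1 / t\<close> is a preimage of \<open>t\<close>.\<close>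

lemma M_surj:
  assumes "unimodular t"
  obtains v where "v \<noteq> 0" "M v = t"
proof -
  obtain w where w: "w\<^sup>2 = 1 / t" using square_root_exists by blast
  obtain v where v: "v\<^sup>2 = w" using square_root_exists by blast
  have "v ^ 4 = (v\<^sup>2)\<^sup>2" by (simp flip: power_mult)
  then have v4: "v ^ 4 = 1 / t" by (simp only: v w)
  have "unimodular (1 / t)"
    using unimodularD[OF assms] by (simp add: unimodular_def F_simps)
  then have "unimodular v" using v w unimodular_square_iff by metis
  from M_unimodular[OF this] v4 have "M v = t" by simp
  moreover have "v \<noteq> 0" using v4 unimodularD(1)[OF assms] by auto
  ultimately show ?thesis by (rule that[rotated])
qed

text \<open>
  Otherwise \<open>M x = 1\<close> for all nonzero \<open>x\<close>, and every element of the field is a root of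
  \<open>X ^ (q\<^sup>3 + q) - X ^ (q\<^sup>2 + 1)\<close>, whose degree is too small for that.
\<close>

lemma unimodular_neq_1_exists: "\<exists>r. unimodular r \<and> r \<noteq> 1"
proof (rule ccontr)
  assume none: "\<not> ?thesis"
  define p :: "'a poly" where "p = monom 1 (q ^ 3 + q) - monom 1 (q\<^sup>2 + 1)"
  have root: "poly p x = 0" for x
  proof (cases "x = 0")
    case True
    then show ?thesis using q_ge_2 by (simp add: p_def poly_monom)
  next
    case False
    then have "M x = 1" using none unimodular_M by blast
    then have "F x * F (F (F x)) = x * F (F x)" using False by (simp add: M_def F_simps)
    then have "x ^ q * x ^ q ^ 3 = x * x ^ q\<^sup>2"
      using F_F[of x] F_F_F[of x] by (simp add: F_def)
    then show ?thesis by (simp add: p_def poly_monom power_add mult.commute)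
  qed
  have "q\<^sup>2 < q ^ 3" using q_ge_2 by (intro power_strict_increasing) auto
  then have deg_less: "q\<^sup>2 + 1 < q ^ 3 + q" using q_ge_2 by linarith
  then have "coeff p (q ^ 3 + q) = 1" by (simp add: p_def)
  then have "p \<noteq> 0" by auto
  then have "card {x. poly p x = 0} \<le> degree p" by (rule card_poly_roots_bound)
  also have "degree p \<le> q ^ 3 + q"
    unfolding p_def using deg_less by (intro degree_diff_le order.trans[OF degree_monom_le]) auto
  finally have "q ^ 4 \<le> q ^ 3 + q" using root by (simp add: card_field)
  moreover have "q ^ 4 = q * q ^ 3" by (simp add: eval_nat_numeral)
  then have "q ^ 4 \<ge> 2 * q ^ 3" using q_ge_2 by simp
  moreover have "q ^ 3 > q" using power_strict_increasing[of 1 3 q] q_ge_2 by simp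
  ultimately show False by linarith
qed

section \<open>Injectivity of \<open>x\<^sup>2 (M x + b)\<close>\<close>

definition g :: "'a \<Rightarrow> 'a \<Rightarrow> 'a" where "g b x = x\<^sup>2 * (M x + b)"

lemma M_g: "M (g b x) = (M x)\<^sup>2 * M (M x + b)"
  by (simp add: g_def M_mult M_power)

lemma square_times_M_shift:
  assumes "unimodular t"
  shows "t\<^sup>2 * M (t + b) =
    (1 + F b * t) * (1 + F (F (F b)) * t) / ((t + b) * (t + F (F b)))"
proof -
  have t: "t \<noteq> 0" and Ft: "F t = 1 / t" using unimodularD[OF assms] by auto
  have 1: "F (t + b) = (1 + F b * t) / t"
    using t by (simp add: F_add Ft add_divide_distrib)
  have 2: "F (F (t + b)) = t + F (F b)"
    using t by (simp add: F_simps Ft)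
  have 3: "F (F (F (t + b))) = (1 + F (F (F b)) * t) / t"
    using t by (simp add: F_add Ft F_simps add_divide_distrib)
  have "M (t + b) = (1 + F b * t) / t * ((1 + F (F (F b)) * t) / t) / ((t + b) * (t + F (F b)))"
    by (subst M_def, subst 3, subst 2, subst 1) (rule refl)
  then show ?thesis using t by (simp add: power2_eq_square)
qed

text \<open>
  With \<open>F (F b) = b\<close>, \<open>M (g b x)\<close> is the square of \<open>(1 + F b * t) / (t + b)\<close> for \<open>t = M x\<close>, and this
  fractional linear map has determinant \<open>b * F b - 1\<close>. So \<open>g b x\<close> determines \<open>M x\<close>, hence \<open>x\<^sup>2\<close>
  and \<open>x\<close>.
\<close>

lemma inj_g:
  assumes fixed: "F (F b) = b" and not_unimodular: "\<not> unimodular b"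
  shows "inj (g b)"
proof (rule injI)
  have g_eq_0: "g b x = 0 \<longleftrightarrow> x = 0" for x
    using unimodular_M[of x] not_unimodular by (auto simp: g_def add_eq_0_iff_eq)
  fix x y assume eq: "g b x = g b y"
  show "x = y"
  proof (cases "x = 0")
    case True
    then show ?thesis using eq g_eq_0 by metis
  next
    case False
    then have nz: "x \<noteq> 0" "y \<noteq> 0" using eq g_eq_0 by metis+
    define s t where "s = M x" and "t = M y"
    have uni: "unimodular s" "unimodular t" using nz unimodular_M by (simp_all add: s_def t_def)
    have nz': "s + b \<noteq> 0" "t + b \<noteq> 0" using uni not_unimodular add_eq_0_iff_eq by metis+
    have "s\<^sup>2 * M (s + b) = t\<^sup>2 * M (t + b)" using eq M_g by (metis s_def t_def)
    then have "(1 + F b * s) * (1 + F b * s) / ((s + b) * (s + b)) =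
        (1 + F b * t) * (1 + F b * t) / ((t + b) * (t + b))"
      by (simp only: square_times_M_shift uni fixed)
    then have "((1 + F b * s) / (s + b))\<^sup>2 = ((1 + F b * t) / (t + b))\<^sup>2"
      by (simp add: power2_eq_square)
    then have "(1 + F b * s) * (t + b) = (1 + F b * t) * (s + b)"
      using nz' by (simp add: square_inj frac_eq_eq)
    then have "(1 - b * F b) * (s - t) = 0" by (simp add: algebra_simps)
    then have "s = t" using not_unimodular by (auto simp: unimodular_def)
    then have "x\<^sup>2 * (s + b) = y\<^sup>2 * (s + b)" using eq by (simp add: g_def s_def t_def)
    then show "x = y" using nz' by (simp add: square_inj)
  qed
qed

lemma not_inj_g_unimodular:
  assumes "unimodular b"
  shows "\<not> inj (g b)"
proof -
  obtain v where v: "v \<noteq> 0" "M v = b" using M_surj[OF assms] .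
  then have "g b v = g b 0" by (simp add: g_def double)
  with v show ?thesis by (auto dest: injD)
qed

text \<open>
  With \<open>T = b + F (F b)\<close> and \<open>B = b * F (F b)\<close>, the denominator of \<open>t\<^sup>2 * M (t + b)\<close> is
  \<open>t\<^sup>2 + T t + B\<close> and the numerator is \<open>1 + F T t + F B t\<^sup>2\<close>. Cross multiplying
  the equation for \<open>s\<close> and \<open>t\<close> gives a polynomial that vanishes for \<open>s = t\<close>; this is its
  cofactor after division by \<open>t - s\<close>.
\<close>

lemma square_times_M_shift_eq:
  assumes "unimodular s" "unimodular t" and moved: "F (F b) \<noteq> b"
    and T: "T = b + F (F b)" and B: "B = b * F (F b)"
    and cofactor: "(T - F T * B) + (1 - F B * B) * (s + t) + (F T - F B * T) * (s * t) = 0"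
  shows "s\<^sup>2 * M (s + b) = t\<^sup>2 * M (t + b)"
proof -
  define c d e where cde: "c = F b" "d = F (F b)" "e = F (F (F b))"
  have FT: "F T = c + e" "F B = c * e" by (simp_all add: T B F_simps cde)
  (* s and t lie in the fixed field of F o F, but b and F (F b) do not. *)
  have nz: "u + b \<noteq> 0" "u + d \<noteq> 0" if "unimodular u" for u
  proof -
    have "F (F u) = u" using unimodularD[OF that] by (simp add: F_simps)
    then show "u + b \<noteq> 0" "u + d \<noteq> 0"
      using moved by (auto simp: add_eq_0_iff_eq cde) (metis F_order)
  qed
  have "(1 + c * s) * (1 + e * s) * ((t + b) * (t + d)) - (1 + c * t) * (1 + e * t) * ((s + b) * (s + d))
      = (t - s) * ((b + d - (c + e) * (b * d)) + (1 - c * e * (b * d)) * (s + t)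
          + ((c + e) - c * e * (b + d)) * (s * t))"
    by (simp add: algebra_simps)
  also have "\<dots> = 0" using cofactor by (simp add: T B FT cde(2)[symmetric] flip: FT)
  finally have "(1 + c * s) * (1 + e * s) / ((s + b) * (s + d)) =
      (1 + c * t) * (1 + e * t) / ((t + b) * (t + d))"
    using nz[OF assms(1)] nz[OF assms(2)] by (simp add: frac_eq_eq)
  then show ?thesis by (simp only: square_times_M_shift assms(1,2) cde)
qed

text \<open>
  For unimodular \<open>s\<close> and \<open>t\<close>, applying \<open>F\<close> to the left-hand side divides it by \<open>s * t\<close>. So solving
  the equation for \<open>t\<close> stays in the unimodular elements. In characteristic 2, if \<open>A \<noteq> 0\<close>, only the
  square root of \<open>A / F A\<close> can be paired with itself, and so at least one of any two unimodular \<open>s\<close>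
  has a partner \<open>t \<noteq> s\<close>.
\<close>

lemma bilinear_off_diagonal_solution:
  assumes FE: "F E = E" and FFA: "F (F A) = A" and degenerate: "A = 0 \<Longrightarrow> E = 0"
  obtains s t where "unimodular s" "unimodular t" "s \<noteq> t"
    "A + E * (s + t) + F A * (s * t) = 0"
proof -
  obtain r where r: "unimodular r" "r \<noteq> 1" using unimodular_neq_1_exists by blast
  have one: "unimodular 1" by (simp add: unimodular_def F_1)
  show ?thesis
  proof (cases "A = 0")
    case True
    then show ?thesis using that[OF r(1) one r(2)] degenerate by (simp add: F_0)
  next
    case False
    have "\<not> (A + F A * r\<^sup>2 = 0 \<and> A + F A * 1\<^sup>2 = 0)"
    proof
      assume "A + F A * r\<^sup>2 = 0 \<and> A + F A * 1\<^sup>2 = 0"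
      then have "F A * r\<^sup>2 = F A * 1\<^sup>2" by (metis add_left_imp_eq)
      then have "r = 1" using False by (simp only: mult_cancel_left square_inj F_eq_0 simp_thms)
      with r show False by simp
    qed
    then obtain s s' where s: "unimodular s" "unimodular s'" "s \<noteq> s'" "A + F A * s\<^sup>2 \<noteq> 0"
      using r one by metis
    note s_simps = unimodularD[OF s(1)]
    have F_num: "F (A + E * s) = (E + F A * s) / s"
      using s_simps by (simp add: F_simps FE field_simps)
    have F_den: "F (E + F A * s) = (A + E * s) / s"
      using s_simps by (simp add: F_simps FE FFA field_simps)
    show ?thesis
    proof (cases "E + F A * s = 0")
      (* Here the equation does not involve t at all. *)
      case True
      then have "A + E * s = 0" using F_num by (simp add: F_eq_0)
      with True have "A + E * s + s' * (E + F A * s) = 0" by simp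
      then show ?thesis by (intro that[OF s(1-3)]) (simp add: algebra_simps)
    next
      case den: False
      then have num: "A + E * s \<noteq> 0" using F_num s_simps by (auto simp: F_0)
      define t where "t = - ((A + E * s) / (E + F A * s))"
      have "F t = - (((E + F A * s) / s) / ((A + E * s) / s))"
        unfolding t_def by (simp only: F_minus F_divide F_num F_den)
      also have "\<dots> = 1 / t" using num s_simps by (simp add: t_def)
      finally have Ft: "F t = 1 / t" .
      have "t \<noteq> 0" using num den by (simp only: t_def neg_equal_0_iff_equal divide_eq_0_iff simp_thms)
      then have "unimodular t" by (simp add: unimodular_def Ft)
      moreover have "t * (E + F A * s) = - (A + E * s)" using den by (simp add: t_def)
      then have eq: "A + E * (s + t) + F A * (s * t) = 0" by (simp add: algebra_simps add_eq_0_iff)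
      moreover have "s \<noteq> t"
      proof
        assume "s = t"
        with eq have "A + F A * s\<^sup>2 + (E * s + E * s) = 0"
          by (simp add: algebra_simps power2_eq_square)
        with s(4) show False by (simp add: double)
      qed
      ultimately show ?thesis using that s(1) by blast
    qed
  qed
qed

lemma not_inj_g_moved:
  assumes moved: "F (F b) \<noteq> b"
  shows "\<not> inj (g b)"
proof
  assume inj: "inj (g b)"
  define T B where TB: "T = b + F (F b)" "B = b * F (F b)"
  define A E where AE: "A = T - F T * B" "E = 1 - F B * B"
  have T0: "T \<noteq> 0" using moved by (simp add: TB add_eq_0_iff_eq)
  have FF: "F (F T) = T" "F (F B) = B" by (simp_all add: TB F_simps add.commute mult.commute)
  have FA: "F A = F T - F B * T" by (simp add: AE F_simps FF mult.commute)
  have "F E = E" "F (F A) = A" by (simp_all add: AE F_simps FF mult.commute)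
  moreover have "E = 0" if "A = 0"
  proof -
    have "T = F T * B" using that by (simp add: AE)
    moreover have "F T = F B * T" using FA that by (simp add: F_0)
    ultimately have "T * 1 = T * (F B * B)" by (simp add: mult_ac)
    then show ?thesis using T0 by (simp add: AE)
  qed
  ultimately obtain s t where st: "unimodular s" "unimodular t" "s \<noteq> t"
    and eq: "A + E * (s + t) + F A * (s * t) = 0"
    using bilinear_off_diagonal_solution by metis
  have same: "s\<^sup>2 * M (s + b) = t\<^sup>2 * M (t + b)"
    by (rule square_times_M_shift_eq[OF st(1,2) moved TB]) (use eq in \<open>simp add: AE FA[unfolded AE]\<close>)
  obtain x where x: "x \<noteq> 0" "M x = s" using M_surj[OF st(1)] .
  obtain y where y: "y \<noteq> 0" "M y = t" using M_surj[OF st(2)] .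
  have "g b y \<noteq> 0"
    using injD[OF inj, of y 0] y(1) by (auto simp: g_def)
  have M_same: "M (g b x) = M (g b y)" using same by (simp add: M_g x y)
  (* The values g b x and g b y differ by a factor in the kernel of M; scaling y by the
     square root of this factor makes them equal without changing M y. *)
  obtain l where l: "l\<^sup>2 = g b x / g b y" using square_root_exists by blast
  have "(M l)\<^sup>2 = 1\<^sup>2"
    using M_same \<open>g b y \<noteq> 0\<close> by (simp add: l M_divide M_eq_0 flip: M_power)
  then have Ml: "M l = 1" by (simp only: square_inj)
  have "g b (l * y) = l\<^sup>2 * g b y" by (simp add: g_def M_mult Ml power_mult_distrib)
  also have "\<dots> = g b x" using \<open>g b y \<noteq> 0\<close> by (simp add: l)
  finally have "l * y = x" by (rule injD[OF inj])
  then have "s = t" using M_mult[of l y] x y Ml by simp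
  with st show False by simp
qed

lemma inj_g_iff: "inj (g b) \<longleftrightarrow> F (F b) = b \<and> \<not> unimodular b"
  using inj_g not_inj_g_unimodular not_inj_g_moved by blast

section \<open>The binomial\<close>

lemma exponent_double: "2 * ((q ^ 4 + q ^ 3 - q\<^sup>2 + q) div 2) + q\<^sup>2 = q ^ 4 + q ^ 3 + q"
proof -
  have "q\<^sup>2 \<le> q ^ 3" using q_ge_2 by (intro power_increasing) auto
  moreover from this have "even (q ^ 4 + q ^ 3 - q\<^sup>2 + q)" using even_q by simp
  ultimately show ?thesis by simp
qed

text \<open>
  Doubling the exponent gives \<open>q\<^sup>4 + q\<^sup>3 - q\<^sup>2 + q\<close>, so for nonzero \<open>x\<close> the square of the first term
  is \<open>x * F\<^sup>3 x * F x / F\<^sup>2 x = x\<^sup>2 * M x\<close>.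
\<close>

lemma binomial_square:
  "((x::'a) ^ ((q ^ 4 + q ^ 3 - q\<^sup>2 + q) div 2) + a * x)\<^sup>2 = g (a\<^sup>2) x"
proof (cases "x = 0")
  case True
  have "(q ^ 4 + q ^ 3 - q\<^sup>2 + q) div 2 \<noteq> 0"
    using exponent_double q_ge_2 power_strict_increasing[of 2 4 q] by (intro notI) simp
  with True show ?thesis by (simp add: g_def zero_power)
next
  case False
  let ?e = "(q ^ 4 + q ^ 3 - q\<^sup>2 + q) div 2"
  have "(x ^ ?e)\<^sup>2 * F (F x) = x ^ (2 * ?e + q\<^sup>2)"
    by (simp only: F_F power_add power_mult mult.commute[of 2])
  also have "\<dots> = x * F (F (F x)) * F x"
    by (simp only: exponent_double power_add power_q4 F_F_F) (simp add: F_def)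
  finally have "(x ^ ?e)\<^sup>2 = x\<^sup>2 * M x"
    using False by (simp add: M_def F_simps field_simps power2_eq_square)
  then show ?thesis
    by (simp add: square_add g_def distrib_left power_mult_distrib mult.commute)
qed

lemma permutation_binomial_iff:
  assumes "(a::'a) \<noteq> 0"
  shows "permutation_poly (monom 1 ((q ^ 4 + q ^ 3 - q\<^sup>2 + q) div 2) + monom a 1) \<longleftrightarrow>
    a \<in> mu (q\<^sup>2 - 1) \<and> a \<notin> mu (q + 1)" (is "permutation_poly ?f \<longleftrightarrow> _")
proof -
  have "(poly ?f x)\<^sup>2 = g (a\<^sup>2) x" for x
    using binomial_square[of x a] by (simp add: poly_monom)
  then have "inj (poly ?f) \<longleftrightarrow> inj (g (a\<^sup>2))"
    unfolding inj_def by (metis square_inj)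
  moreover have "permutation_poly ?f \<longleftrightarrow> inj (poly ?f)"
    unfolding permutation_poly_def bij_def using finite_UNIV_inj_surj[OF finite] by blast
  ultimately show ?thesis
    using F_F_fixed_iff_mu[OF assms]
    by (simp only: inj_g_iff unimodular_square_iff F_F_fixed_square_iff flip: unimodular_iff_mu)
qed

end

theorem theorem10:
  fixes n q :: nat
    and a :: "'a::{field,finite}"
    and f3 :: "'a poly"
  assumes "n > 1"
    and "q = 2 ^ n"
    and "card (UNIV :: 'a set) = q ^ 4"
    and "a \<noteq> 0"
    and "f3 = monom 1 (((q ^ 4 - 1) + (q ^ 3 - q ^ 2 + q - 1)) div 2 + 1) + monom a 1"
  shows "f3 = monom 1 ((q ^ 4 + q ^ 3 - q ^ 2 + q) div 2) + monom a 1 \<and>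
    (permutation_poly f3 \<longleftrightarrow> a \<in> mu (q ^ 2 - 1) \<and> a \<notin> mu (q + 1))"
proof -
  interpret char2_quartic_field n q "TYPE('a)"
    using assms by unfold_locales auto
  have "q\<^sup>2 \<le> q ^ 3" using q_ge_2 by (intro power_increasing) auto
  moreover have "1 \<le> q ^ 4" using q_ge_2 by simp
  ultimately have
    "((q ^ 4 - 1) + (q ^ 3 - q ^ 2 + q - 1)) div 2 + 1 = (q ^ 4 + q ^ 3 - q ^ 2 + q) div 2"
    using q_ge_2 by linarith
  then have "f3 = monom 1 ((q ^ 4 + q ^ 3 - q ^ 2 + q) div 2) + monom a 1"
    using assms(5) by simp
  then show ?thesis using permutation_binomial_iff[OF assms(4)] by simp
qed

end
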